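(* Let $H$ be an infinite dimensional real or complex Hilbert space and let $\phi:P_\infty(H)\to P_\infty(H)$ be a surjective map such that $\angle(\phi(P),\phi(Q))=\angle(P,Q)$ for all $P,Q\in P_\infty(H)$. Then there exists a unitary or antiunitary operator $U$ on $H$ such that $\phi(P)=UPU^*$ for all $P\in P_\infty(H)$.
   Context: A projection means a self-adjoint idempotent bounded operator on $H$; $P_\infty(H)$ is the set of all projections of infinite rank. For projections $P,Q,P',Q'$, "$\angle(P,Q)=\angle(P',Q')$" means by definition that the positive operators $QPQ$ and $Q'P'Q'$ are unitarily equivalent (orthogonally equivalent in the real case). In the real case "unitary or antiunitary" means orthogonal. *)

theory Defs
  imports "HOL-Analysis.Analysis"
begin

text \<open>A real Hilbert space is a type of class real_inner and complete_space.
A complex Hilbert space is modelled as its underlying real Hilbert space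
(real inner product = real part of the complex inner product) together with
the orthogonal complex structure J (multiplication by the imaginary unit).
The scalar field is encoded by cs: None = real case, Some J = complex case.\<close>

definition complex_structure :: "('a::real_inner \<Rightarrow> 'a) \<Rightarrow> bool" where
  "complex_structure J \<longleftrightarrow> bounded_linear J \<and> (\<forall>x. J (J x) = - x) \<and> (\<forall>x. norm (J x) = norm x)"

definition scalars_ok :: "('a::real_inner \<Rightarrow> 'a) option \<Rightarrow> bool" where
  "scalars_ok cs \<longleftrightarrow> (case cs of None \<Rightarrow> True | Some J \<Rightarrow> complex_structure J)"

definition K_bounded_linear :: "('a::real_inner \<Rightarrow> 'a) option \<Rightarrow> ('a \<Rightarrow> 'a) \<Rightarrow> bool" where
  "K_bounded_linear cs T \<longleftrightarrow> bounded_linear T \<and>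
     (case cs of None \<Rightarrow> True | Some J \<Rightarrow> (\<forall>x. T (J x) = J (T x)))"

definition infinite_dimensional_set :: "'a::real_vector set \<Rightarrow> bool" where
  "infinite_dimensional_set S \<longleftrightarrow> \<not> (\<exists>B. finite B \<and> S \<subseteq> span B)"

definition is_projection :: "('a::real_inner \<Rightarrow> 'a) option \<Rightarrow> ('a \<Rightarrow> 'a) \<Rightarrow> bool" where
  "is_projection cs P \<longleftrightarrow> K_bounded_linear cs P \<and> P \<circ> P = P \<and>
     (\<forall>x y. inner (P x) y = inner x (P y))"

definition proj_inf :: "('a::real_inner \<Rightarrow> 'a) option \<Rightarrow> ('a \<Rightarrow> 'a) set" where
  "proj_inf cs = {P. is_projection cs P \<and> infinite_dimensional_set (range P)}"

definition unitary_op :: "('a::real_inner \<Rightarrow> 'a) option \<Rightarrow> ('a \<Rightarrow> 'a) \<Rightarrow> bool" where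
  "unitary_op cs U \<longleftrightarrow> K_bounded_linear cs U \<and> surj U \<and> (\<forall>x. norm (U x) = norm x)"

definition antiunitary_op :: "('a::real_inner \<Rightarrow> 'a) option \<Rightarrow> ('a \<Rightarrow> 'a) \<Rightarrow> bool" where
  "antiunitary_op cs U \<longleftrightarrow> (case cs of None \<Rightarrow> False | Some J \<Rightarrow>
     bounded_linear U \<and> (\<forall>x. U (J x) = - J (U x)) \<and> surj U \<and> (\<forall>x. norm (U x) = norm x))"

definition unitarily_equivalent :: "('a::real_inner \<Rightarrow> 'a) option \<Rightarrow> ('a \<Rightarrow> 'a) \<Rightarrow> ('a \<Rightarrow> 'a) \<Rightarrow> bool" where
  "unitarily_equivalent cs A B \<longleftrightarrow> (\<exists>U. unitary_op cs U \<and> U \<circ> A = B \<circ> U)"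

definition same_angle :: "('a::real_inner \<Rightarrow> 'a) option \<Rightarrow> ('a \<Rightarrow> 'a) \<Rightarrow> ('a \<Rightarrow> 'a) \<Rightarrow> ('a \<Rightarrow> 'a) \<Rightarrow> ('a \<Rightarrow> 'a) \<Rightarrow> bool" where
  "same_angle cs P Q P' Q' \<longleftrightarrow> unitarily_equivalent cs (Q \<circ> P \<circ> Q) (Q' \<circ> P' \<circ> Q')"

end

theory Submission
  imports Defs
begin

text \<open>
  Projections \<open>I - p\<close> with \<open>p\<close> of rank one have infinite rank, and \<open>\<phi>\<close> maps them to projections of
  the same kind, so \<open>\<phi>\<close> induces a map of rays \<open>[x] \<mapsto> [T x]\<close>. For a projection \<open>R\<close> and a unit
  vector \<open>x\<close> spanning \<open>p\<close>, the only possible eigenvalue of \<open>R (I - p) R = R - (Rx) \<otimes> (Rx)\<close> in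
  the open interval from 0 to 1 is \<open>1 - \<parallel>Rx\<parallel>\<^sup>2\<close>. Hence \<open>\<parallel>\<phi>(R) T x\<parallel> = \<parallel>Rx\<parallel>\<close> unless one
  of these numbers is 0 or 1. With \<open>R = I - q\<close> this shows that \<open>T\<close> preserves transition
  probabilities, and Wigner's theorem yields \<open>U\<close> with \<open>[T x] = [U x]\<close>. Finally, the quadratic
  forms of \<open>U\<^sup>* \<phi>(R) U\<close> and \<open>R\<close> agree at every unit vector that is in neither the range nor the
  kernel of \<open>R\<close>, hence everywhere.

  Wigner's theorem is proved by Bargmann's method: in the affine charts \<open>[e + x]\<close> and
  \<open>[T e + V x]\<close> the ray map becomes a map \<open>V\<close> between orthogonal complements that satisfies
  \<open>|1 + \<langle>V x, V y\<rangle>| = |1 + \<langle>x, y\<rangle>|\<close>. This makes \<open>V\<close> positively homogeneous, and comparing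
  different scalings then shows that it preserves the real inner product.
\<close>

section \<open>Rays over the reals and the complex numbers\<close>

text \<open>Real scalars are treated together with complex ones by taking \<open>J = 0\<close>; then
  \<open>J \<circ> J = -\<epsilon>\<close> with \<open>\<epsilon> = 0\<close> in the real and \<open>\<epsilon> = 1\<close> in the complex case.\<close>

locale scalar_field =
  fixes cs :: "('a::real_inner \<Rightarrow> 'a) option" and J :: "'a \<Rightarrow> 'a" and \<epsilon> :: real
  assumes linear_J: "linear J"
    and J_skew: "inner (J x) y = - inner x (J y)"
    and J_J: "J (J x) = - (\<epsilon> *\<^sub>R x)"
    and cs_cases: "cs = None \<and> (\<forall>x. J x = 0) \<and> \<epsilon> = 0 \<or> cs = Some J \<and> \<epsilon> = 1"

text \<open>Polarizing the norm identity makes a complex structure orthogonal. Together with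
  \<open>J (J x) = - x\<close>, orthogonality is skewness.\<close>

lemma scalar_field_of_scalars_ok:
  assumes "scalars_ok cs"
  obtains J \<epsilon> where "scalar_field cs J \<epsilon>"
proof (cases cs)
  case None
  have "scalar_field None (\<lambda>_::'a. 0) 0"
    by unfold_locales (auto simp: linear_iff)
  then show ?thesis using None that by blast
next
  case (Some J)
  with assms have J: "bounded_linear J" "\<And>x. J (J x) = - x" "\<And>x. norm (J x) = norm x"
    by (auto simp: scalars_ok_def complex_structure_def)
  then have lin: "linear J" by (simp add: bounded_linear.linear)
  have iso: "inner (J x) (J y) = inner x y" for x y
    using J(3)[of "x + y"] J(3)[of x] J(3)[of y]
    by (simp add: norm_eq linear_add[OF lin] inner_add inner_commute)
  have "inner (J x) y = - inner x (J y)" for x y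
    using iso[of x "J y"] J(2)[of y] by simp
  with lin J(2) have "scalar_field (Some J) J 1"
    by (simp add: scalar_field_def)
  then show ?thesis using Some that by blast
qed

context scalar_field
begin

lemma J_simps [simp]:
  "J (x + y) = J x + J y" "J (x - y) = J x - J y" "J (- x) = - J x"
  "J (r *\<^sub>R x) = r *\<^sub>R J x" "J 0 = 0"
  using linear_J by (auto simp: linear_add linear_diff linear_neg linear_scale linear_0)

lemma \<epsilon>_cases: "(\<forall>x. J x = 0) \<and> \<epsilon> = 0 \<or> \<epsilon> = 1"
  using cs_cases by auto

lemma inner_J_J: "inner (J x) (J y) = \<epsilon> * inner x y"
  by (simp add: J_skew J_J)

lemma inner_J_self [simp]: "inner (J x) x = 0" "inner x (J x) = 0"
  using J_skew[of x x] by (auto simp: inner_commute)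

text \<open>With the \<open>K\<close>-valued inner product \<open>\<langle>x, z\<rangle>\<close>, \<open>ray_op x z\<close> is \<open>\<langle>x, z\<rangle> x\<close> and
  \<open>trans_prob x y\<close> is \<open>|\<langle>x, y\<rangle>|\<^sup>2\<close>.\<close>

definition ray_op :: "'a \<Rightarrow> 'a \<Rightarrow> 'a" where
  "ray_op x z = inner x z *\<^sub>R x + inner (J x) z *\<^sub>R J x"

definition trans_prob :: "'a \<Rightarrow> 'a \<Rightarrow> real" where
  "trans_prob x y = (inner x y)\<^sup>2 + (inner (J x) y)\<^sup>2"

text \<open>For a unit vector \<open>x\<close> this is \<open>I - p\<close>, with \<open>p\<close>
  the projection onto the scalar line through \<open>x\<close>.\<close>

definition coray_proj :: "'a \<Rightarrow> 'a \<Rightarrow> 'a" where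
  "coray_proj x z = z - ray_op x z"

lemma trans_prob_nonneg: "0 \<le> trans_prob x y"
  by (simp add: trans_prob_def)

lemma trans_prob_commute: "trans_prob x y = trans_prob y x"
  using J_skew[of x y] by (simp add: trans_prob_def inner_commute)

lemma trans_prob_self: "trans_prob x x = (norm x) ^ 4"
  by (simp add: trans_prob_def power2_norm_eq_inner[symmetric])

lemma inner_ray_op: "inner (ray_op x y) y = trans_prob x y"
  by (simp add: ray_op_def trans_prob_def inner_left_distrib power2_eq_square)

lemma trans_prob_eq_0_iff: "trans_prob x y = 0 \<longleftrightarrow> inner x y = 0 \<and> inner (J x) y = 0"
  by (simp add: trans_prob_def sum_power2_eq_zero_iff)

lemma linear_ray_op: "linear (ray_op x)"
  by (rule linearI) (simp_all add: ray_op_def inner_add algebra_simps)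

lemma ray_op_J: "ray_op x (J z) = J (ray_op x z)"
  using \<epsilon>_cases by (auto simp: ray_op_def J_J J_skew[of x z] inner_J_J algebra_simps)

lemma ray_op_self: "ray_op x x = (norm x)\<^sup>2 *\<^sub>R x"
  by (simp add: ray_op_def power2_norm_eq_inner)

lemma ray_op_ray_op: "ray_op x (ray_op x z) = (norm x)\<^sup>2 *\<^sub>R ray_op x z"
proof -
  have "ray_op x (ray_op x z) = inner x z *\<^sub>R ray_op x x + inner (J x) z *\<^sub>R ray_op x (J x)"
    by (simp add: ray_op_def[of x z] linear_add[OF linear_ray_op] linear_scale[OF linear_ray_op])
  then show ?thesis
    by (simp add: ray_op_J ray_op_self ray_op_def[of x z] algebra_simps)
qed

text \<open>The vector is the scalar \<open>a + b i\<close> times \<open>x\<close>. In the real case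
  \<open>J\<close> vanishes, so the modulus formula requires \<open>b = 0\<close> there.\<close>

lemma norm_scalar_mult:
  assumes "\<epsilon> = 0 \<Longrightarrow> b = 0"
  shows "(norm (a *\<^sub>R x + b *\<^sub>R J x))\<^sup>2 = (a\<^sup>2 + b\<^sup>2) * (norm x)\<^sup>2"
  unfolding power2_norm_eq_inner using \<epsilon>_cases assms
  by (auto simp: inner_add inner_J_J inner_commute power2_eq_square algebra_simps)

lemma trans_prob_scalar_mult:
  assumes "\<epsilon> = 0 \<Longrightarrow> b = 0"
  shows "trans_prob (a *\<^sub>R x + b *\<^sub>R J x) y = (a\<^sup>2 + b\<^sup>2) * trans_prob x y"
  using \<epsilon>_cases assms
  by (auto simp: trans_prob_def inner_add inner_diff J_J power2_eq_square algebra_simps)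

lemma inner_J_eq_0: "\<epsilon> = 0 \<Longrightarrow> inner (J x) y = 0"
  using \<epsilon>_cases by auto

lemma norm_ray_op: "(norm (ray_op x y))\<^sup>2 = trans_prob x y * (norm x)\<^sup>2"
  unfolding ray_op_def trans_prob_def by (rule norm_scalar_mult) (rule inner_J_eq_0)

text \<open>A division-free identity that contains both the Cauchy-Schwarz inequality and its
  equality case.\<close>

lemma norm_diff_ray_op:
  "(norm ((norm x)\<^sup>2 *\<^sub>R y - ray_op x y))\<^sup>2 = (norm x)\<^sup>2 * ((norm x)\<^sup>2 * (norm y)\<^sup>2 - trans_prob x y)"
proof -
  have "(norm ((norm x)\<^sup>2 *\<^sub>R y - ray_op x y))\<^sup>2 =
      ((norm x)\<^sup>2)\<^sup>2 * (norm y)\<^sup>2 - 2 * (norm x)\<^sup>2 * inner (ray_op x y) y + (norm (ray_op x y))\<^sup>2"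
    unfolding power2_norm_eq_inner
    by (simp add: inner_diff inner_commute power2_eq_square algebra_simps)
  then show ?thesis
    by (simp only: inner_ray_op norm_ray_op) (simp add: algebra_simps power2_eq_square)
qed

lemma trans_prob_le: "trans_prob x y \<le> (norm x)\<^sup>2 * (norm y)\<^sup>2"
proof (cases "x = 0")
  case False
  then have "0 < (norm x)\<^sup>2" by simp
  moreover have "0 \<le> (norm x)\<^sup>2 * ((norm x)\<^sup>2 * (norm y)\<^sup>2 - trans_prob x y)"
    by (subst norm_diff_ray_op[symmetric]) simp
  ultimately show ?thesis by (simp add: zero_le_mult_iff)
qed (simp add: trans_prob_def)

lemma ray_op_eq_self:
  assumes "norm x = 1" "norm y = 1" "trans_prob x y = 1"
  shows "ray_op x y = y"
  using norm_diff_ray_op[of x y] assms by simp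

text \<open>By the equality case, \<open>y\<close> is \<open>x\<close> times a scalar of modulus
  one, and this phase cancels in the rank-one operator.\<close>

lemma ray_op_cong:
  assumes "norm x = 1" "norm y = 1" "trans_prob x y = 1"
  shows "ray_op x = ray_op y"
proof
  fix z
  obtain a b where ab: "a = inner x y" "b = inner (J x) y" by simp
  have y: "y = a *\<^sub>R x + b *\<^sub>R J x"
    using ray_op_eq_self[OF assms] by (simp add: ray_op_def ab)
  have b0: "\<epsilon> = 0 \<Longrightarrow> b = 0" by (simp add: ab inner_J_eq_0)
  have 1: "a * a + b * b = 1"
    using assms(3) by (simp add: trans_prob_def ab power2_eq_square)
  have "ray_op y z = (a * a + b * b) *\<^sub>R ray_op x z"
    using \<epsilon>_cases b0
    by (auto simp: ray_op_def y inner_add inner_diff J_J algebra_simps)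
  then show "ray_op x z = ray_op y z" by (simp add: 1)
qed

lemma linear_coray_proj: "linear (coray_proj x)"
  unfolding coray_proj_def by (intro linear_compose_sub linear_ray_op linear_ident)

lemma norm_coray_proj:
  assumes "norm x = 1"
  shows "(norm (coray_proj x y))\<^sup>2 = (norm y)\<^sup>2 - trans_prob x y"
  using norm_diff_ray_op[of x y] assms by (simp add: coray_proj_def)

lemma trans_prob_if_coray_proj_eq:
  assumes "norm x = 1" "norm y = 1" "coray_proj x = coray_proj y"
  shows "trans_prob x z = trans_prob y z"
proof -
  have "ray_op x z = ray_op y z"
    using fun_cong[OF assms(3), of z] by (simp add: coray_proj_def)
  then show ?thesis by (metis inner_ray_op)
qed

section \<open>Unitary equivalence and coray projections\<close>

text \<open>Characterizes \<open>unitary_op\<close> uniformly in both scalar cases; boundedness is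
  automatic for a linear isometry.\<close>

definition K_isometry :: "('a \<Rightarrow> 'a) \<Rightarrow> bool" where
  "K_isometry V \<longleftrightarrow> linear V \<and> (\<forall>x. V (J x) = J (V x)) \<and> surj V \<and> (\<forall>x. norm (V x) = norm x)"

lemma bounded_linear_isometry:
  assumes "linear V" "\<And>x. norm (V x) = norm x"
  shows "bounded_linear V"
  using assms by (intro bounded_linear_intro[of _ 1]) (auto simp: linear_add linear_scale)

lemma K_bounded_linear_iff:
  "K_bounded_linear cs T \<longleftrightarrow> bounded_linear T \<and> (\<forall>x. T (J x) = J (T x))"
  using cs_cases by (auto simp: K_bounded_linear_def linear_simps)

lemma unitary_op_iff: "unitary_op cs V \<longleftrightarrow> K_isometry V"
  unfolding unitary_op_def K_isometry_def K_bounded_linear_iff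
  using bounded_linear_isometry bounded_linear.linear by blast

lemma inner_isometry:
  assumes "linear V" "\<And>x. norm (V x) = norm x"
  shows "inner (V x) (V y) = inner x y"
  using assms(2)[of "x + y"] assms(2)[of x] assms(2)[of y]
  by (simp add: norm_eq linear_add[OF assms(1)] inner_add inner_commute)

lemma inj_isometry:
  assumes "linear V" "\<And>x. norm (V x) = norm x"
  shows "inj V"
  by (metis assms linear_injective_0 norm_eq_zero)

lemma K_isometry_ray_op:
  assumes "K_isometry V"
  shows "ray_op (V x) (V z) = V (ray_op x z)"
proof -
  have V: "linear V" "\<And>x. J (V x) = V (J x)" "\<And>x. norm (V x) = norm x"
    using assms by (auto simp: K_isometry_def)
  show ?thesis
    by (simp add: ray_op_def V(2) inner_isometry[OF V(1,3)] linear_add[OF V(1)] linear_scale[OF V(1)])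
qed

lemma K_isometry_inv:
  assumes "K_isometry V"
  shows "K_isometry (inv V)"
proof -
  have V: "linear V" "\<And>x. V (J x) = J (V x)" "\<And>x. norm (V x) = norm x" "surj V"
    using assms by (auto simp: K_isometry_def)
  have inj: "inj V" using inj_isometry V by blast
  have [simp]: "V (inv V x) = x" for x by (simp add: V(4) surj_f_inv_f)
  have [simp]: "inv V (V x) = x" for x by (simp add: inj)
  have "linear (inv V)"
  proof (rule linearI)
    show "inv V (x + y) = inv V x + inv V y" for x y
      by (rule injD[OF inj]) (simp add: linear_add[OF V(1)])
    show "inv V (r *\<^sub>R x) = r *\<^sub>R inv V x" for r x
      by (rule injD[OF inj]) (simp add: linear_scale[OF V(1)])
  qed
  moreover have "inv V (J x) = J (inv V x)" for x
    by (rule injD[OF inj]) (simp add: V(2))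
  moreover have "norm (inv V x) = norm x" for x
    using V(3)[of "inv V x"] by simp
  moreover have "surj (inv V)" by (rule surjI[of _ V]) simp
  ultimately show ?thesis by (simp add: K_isometry_def)
qed

lemma unitarily_equivalent_sym:
  assumes "unitarily_equivalent cs A B"
  shows "unitarily_equivalent cs B A"
proof -
  obtain V where V: "K_isometry V" "V \<circ> A = B \<circ> V"
    using assms by (auto simp: unitarily_equivalent_def unitary_op_iff)
  then have inj: "inj V" and surj: "surj V" by (auto simp: K_isometry_def inj_isometry)
  have "inv V (B x) = A (inv V x)" for x
    using fun_cong[OF V(2), of "inv V x"] inj surj by (simp add: surj_f_inv_f inv_f_eq)
  then have "inv V \<circ> B = A \<circ> inv V" by auto
  with K_isometry_inv[OF V(1)] show ?thesis
    by (auto simp: unitarily_equivalent_def unitary_op_iff)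
qed

text \<open>Conjugating by a unitary \<open>V\<close> moves the ray: the operator belongs to the
  preimage of \<open>x\<close> under \<open>V\<close>.\<close>

lemma unitarily_equivalent_coray_proj:
  assumes "unitarily_equivalent cs A (coray_proj x)" "norm x = 1"
  obtains y where "norm y = 1" "A = coray_proj y"
proof -
  obtain V where V: "K_isometry V" "V \<circ> A = coray_proj x \<circ> V"
    using assms by (auto simp: unitarily_equivalent_def unitary_op_iff)
  then have lin: "linear V" and iso: "\<And>x. norm (V x) = norm x" and surj: "surj V" and inj: "inj V"
    by (auto simp: K_isometry_def inj_isometry)
  obtain y where y: "x = V y" using surj by blast
  have "V (A z) = V (coray_proj y z)" for z
    using fun_cong[OF V(2), of z] K_isometry_ray_op[OF V(1), of y z]
    by (simp add: coray_proj_def y linear_diff[OF lin])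
  then have "A = coray_proj y" using inj by (auto simp: inj_def)
  moreover have "norm y = 1" using y iso assms(2) by simp
  ultimately show ?thesis using that by blast
qed

section \<open>Projections and the spectra of compressed coray projections\<close>

lemma projectionD:
  assumes "is_projection cs R"
  shows "linear R" "R (J x) = J (R x)" "R (R x) = R x" "inner (R x) y = inner x (R y)"
  using assms unfolding is_projection_def K_bounded_linear_iff
  by (auto simp: bounded_linear.linear dest: fun_cong[of _ _ x])

lemma projection_norm_complement:
  assumes "is_projection cs R"
  shows "(norm (x - R x))\<^sup>2 = (norm x)\<^sup>2 - (norm (R x))\<^sup>2"
proof -
  have "inner (R x) (R x) = inner (R x) x" "inner x (R x) = inner (R x) x"
    using projectionD(3,4)[OF assms] by metis+
  then show ?thesis by (simp add: power2_norm_eq_inner inner_diff)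
qed

lemma coray_proj_in_proj_inf:
  assumes "infinite_dimensional_set (UNIV :: 'a set)" "norm x = 1"
  shows "coray_proj x \<in> proj_inf cs"
proof -
  have "norm (coray_proj x z) \<le> norm z * 1" for z
    using norm_coray_proj[OF assms(2), of z] trans_prob_nonneg[of x z]
    by (simp add: power2_le_imp_le[OF _ norm_ge_zero])
  then have "bounded_linear (coray_proj x)"
    by (intro bounded_linear_intro[of _ 1])
      (simp_all add: linear_add[OF linear_coray_proj] linear_scale[OF linear_coray_proj])
  moreover have "coray_proj x (J z) = J (coray_proj x z)" for z
    by (simp add: coray_proj_def ray_op_J)
  moreover have "coray_proj x \<circ> coray_proj x = coray_proj x"
    by (auto simp: coray_proj_def linear_diff[OF linear_ray_op] ray_op_ray_op assms(2))
  moreover have "inner (coray_proj x y) z = inner y (coray_proj x z)" for y z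
    by (simp add: coray_proj_def ray_op_def inner_diff inner_add inner_commute)
  ultimately have "is_projection cs (coray_proj x)"
    by (simp add: is_projection_def K_bounded_linear_iff)
  moreover have "infinite_dimensional_set (range (coray_proj x))"
    unfolding infinite_dimensional_set_def
  proof
    assume "\<exists>B. finite B \<and> range (coray_proj x) \<subseteq> span B"
    then obtain B where B: "finite B" "range (coray_proj x) \<subseteq> span B" by blast
    \<comment> \<open>Since \<open>z\<close> is \<open>coray_proj x z + ray_op x z\<close>, adding
      \<open>x\<close> and \<open>J x\<close> to a finite spanning set of the range would span the
      whole space.\<close>
    have "z \<in> span (insert x (insert (J x) B))" for z
    proof -
      have "coray_proj x z \<in> span (insert x (insert (J x) B))"
        using B(2) span_mono[of B "insert x (insert (J x) B)"] by blast
      moreover have "ray_op x z \<in> span (insert x (insert (J x) B))"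
        unfolding ray_op_def by (intro span_add span_scale span_base) auto
      ultimately have "coray_proj x z + ray_op x z \<in> span (insert x (insert (J x) B))"
        by (rule span_add)
      then show ?thesis by (simp add: coray_proj_def)
    qed
    then have "finite (insert x (insert (J x) B)) \<and> UNIV \<subseteq> span (insert x (insert (J x) B))"
      using B(1) by auto
    then show False
      using assms(1) unfolding infinite_dimensional_set_def by (metis (no_types))
  qed
  ultimately show ?thesis by (simp add: proj_inf_def)
qed

text \<open>On the range of \<open>R\<close> the compression is the identity minus
  \<open>ray_op (R x)\<close>, whose only possible nonzero eigenvalue is the squared norm of
  \<open>R x\<close>. The values 0 and 1 are excluded because they can occur for other
  reasons.\<close>

lemma coray_compression_eigenvalue_iff:
  assumes R: "is_projection cs R" and x: "norm x = 1" and l: "0 < l" "l < 1"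
  shows "(\<exists>z. z \<noteq> 0 \<and> (R \<circ> coray_proj x \<circ> R) z = l *\<^sub>R z) \<longleftrightarrow> l = 1 - (norm (R x))\<^sup>2"
proof -
  note RD = projectionD[OF R]
  let ?u = "R x"
  have A: "(R \<circ> coray_proj x \<circ> R) z = R z - ray_op ?u z" for z
  proof -
    have 1: "inner x (R z) = inner ?u z" using RD(4) by simp
    have 2: "inner (J x) (R z) = inner (J ?u) z" using RD(2,4) by metis
    have "R (ray_op x (R z)) = ray_op ?u z"
      by (simp add: ray_op_def linear_add[OF RD(1)] linear_scale[OF RD(1)] 1 2 RD(2))
    then show ?thesis by (simp add: coray_proj_def linear_diff[OF RD(1)] RD(3))
  qed
  show ?thesis
  proof
    assume "\<exists>z. z \<noteq> 0 \<and> (R \<circ> coray_proj x \<circ> R) z = l *\<^sub>R z"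
    then obtain z where z: "z \<noteq> 0" "(R \<circ> coray_proj x \<circ> R) z = l *\<^sub>R z" by blast
    \<comment> \<open>An eigenvector with nonzero eigenvalue lies in the range of
      \<open>R\<close>.\<close>
    have "R (l *\<^sub>R z) = l *\<^sub>R z"
      unfolding z(2)[symmetric] by (simp add: RD(3))
    then have "R z = z" using l by (simp add: linear_scale[OF RD(1)])
    then have eq: "ray_op ?u z = (1 - l) *\<^sub>R z"
      using z(2) unfolding A by (simp add: algebra_simps)
    have "(1 - l) *\<^sub>R ray_op ?u z = (norm ?u)\<^sup>2 *\<^sub>R ray_op ?u z"
      using ray_op_ray_op[of ?u z] linear_scale[OF linear_ray_op, of ?u "1 - l" z] eq by metis
    moreover have "ray_op ?u z \<noteq> 0" using eq z(1) l by simp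
    ultimately show "l = 1 - (norm ?u)\<^sup>2" by simp
  next
    assume l': "l = 1 - (norm ?u)\<^sup>2"
    then have "?u \<noteq> 0" using l by auto
    moreover have "(R \<circ> coray_proj x \<circ> R) ?u = l *\<^sub>R ?u"
      unfolding A using l' by (simp add: RD(3) ray_op_self scaleR_left_diff_distrib)
    ultimately show "\<exists>z. z \<noteq> 0 \<and> (R \<circ> coray_proj x \<circ> R) z = l *\<^sub>R z" by blast
  qed
qed

lemma unitarily_equivalent_eigenvalue:
  assumes "unitarily_equivalent cs A B" "\<exists>z. z \<noteq> 0 \<and> A z = l *\<^sub>R z"
  shows "\<exists>z. z \<noteq> 0 \<and> B z = l *\<^sub>R z"
proof -
  obtain V where V: "linear V" "\<And>x. norm (V x) = norm x" "V \<circ> A = B \<circ> V"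
    using assms(1) by (auto simp: unitarily_equivalent_def unitary_op_iff K_isometry_def)
  obtain z where z: "z \<noteq> 0" "A z = l *\<^sub>R z" using assms(2) by blast
  have "B (V z) = l *\<^sub>R V z"
    using fun_cong[OF V(3), of z] z(2) by (simp add: linear_scale[OF V(1)])
  moreover have "V z \<noteq> 0" using V(2)[of z] z(1) by auto
  ultimately show ?thesis by blast
qed

text \<open>The eigenvalue of the unprimed compression lies strictly between 0 and 1, so it passes
  to the primed side and identifies the norm there.\<close>

lemma projection_norm_eq_if_same_angle:
  assumes "is_projection cs R" "is_projection cs R'" "norm x = 1" "norm x' = 1"
    and "unitarily_equivalent cs (R \<circ> coray_proj x \<circ> R) (R' \<circ> coray_proj x' \<circ> R')"
    and "0 < (norm (R x))\<^sup>2" "(norm (R x))\<^sup>2 < 1"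
  shows "(norm (R' x'))\<^sup>2 = (norm (R x))\<^sup>2"
proof -
  let ?l = "1 - (norm (R x))\<^sup>2"
  have l: "0 < ?l" "?l < 1" using assms by auto
  have "\<exists>z. z \<noteq> 0 \<and> (R \<circ> coray_proj x \<circ> R) z = ?l *\<^sub>R z"
    using coray_compression_eigenvalue_iff[OF assms(1,3) l] by simp
  then have "?l = 1 - (norm (R' x'))\<^sup>2"
    using unitarily_equivalent_eigenvalue[OF assms(5)]
      coray_compression_eigenvalue_iff[OF assms(2,4) l] by blast
  then show ?thesis by simp
qed

section \<open>Wigner's theorem\<close>

definition perp :: "'a \<Rightarrow> 'a set" where
  "perp e = {x. inner e x = 0 \<and> inner (J e) x = 0}"

lemma perp_closed:
  assumes "x \<in> perp e"
  shows "y \<in> perp e \<Longrightarrow> x + y \<in> perp e" "r *\<^sub>R x \<in> perp e" "J x \<in> perp e"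
  using assms J_skew[of e x] by (auto simp: perp_def inner_add inner_J_J)

lemma coray_proj_in_perp:
  assumes "norm e = 1"
  shows "coray_proj e w \<in> perp e"
proof -
  have "inner e e = 1" using assms by (simp add: norm_eq_1)
  moreover have "inner (J e) (J e) = \<epsilon>" using assms by (simp add: inner_J_J norm_eq_1)
  ultimately show ?thesis
    using \<epsilon>_cases by (auto simp: perp_def coray_proj_def ray_op_def inner_diff inner_add)
qed

lemma coray_proj_eq_self: "x \<in> perp e \<Longrightarrow> coray_proj e x = x"
  by (simp add: perp_def coray_proj_def ray_op_def)

lemma norm_add_perp:
  assumes "norm e = 1" "x \<in> perp e"
  shows "(norm (e + x))\<^sup>2 = 1 + (norm x)\<^sup>2"
  using assms by (simp add: power2_norm_eq_inner inner_add inner_commute perp_def norm_eq_1)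

lemma trans_prob_add_perp:
  assumes "norm e = 1" "x \<in> perp e" "y \<in> perp e"
  shows "trans_prob (e + x) (e + y) = (1 + inner x y)\<^sup>2 + (inner (J x) y)\<^sup>2"
  using assms J_skew[of x e]
  by (simp add: trans_prob_def inner_add inner_commute perp_def norm_eq_1)

lemma trans_prob_scaleR: "trans_prob (r *\<^sub>R x) y = r\<^sup>2 * trans_prob x y"
  by (simp add: trans_prob_def power_mult_distrib algebra_simps)

text \<open>The ray of \<open>T w\<close>, for \<open>w\<close> the normalized \<open>e + x\<close>,
  is not orthogonal to \<open>T e\<close>, so it has a unique representative with component exactly
  \<open>T e\<close>; \<open>v\<close> is the rest.\<close>

lemma wigner_chart_point:
  assumes T: "\<And>x. norm x = 1 \<Longrightarrow> norm (T x) = 1"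
    "\<And>x y. norm x = 1 \<Longrightarrow> norm y = 1 \<Longrightarrow> trans_prob (T x) (T y) = trans_prob x y"
    and e: "norm e = 1" and x: "x \<in> perp e"
  shows "\<exists>v\<in>perp (T e). norm v = norm x \<and>
    (\<forall>z. trans_prob (T e + v) z = (norm (e + x))\<^sup>2 * trans_prob (T ((e + x) /\<^sub>R norm (e + x))) z)"
proof -
  let ?n = "norm (e + x)"
  define w where "w = (e + x) /\<^sub>R ?n"
  define a where "a = inner (T e) (T w)"
  define b where "b = inner (J (T e)) (T w)"
  have n2: "?n\<^sup>2 = 1 + (norm x)\<^sup>2" by (rule norm_add_perp[OF e x])
  then have "?n \<noteq> 0" by (metis add_nonneg_eq_0_iff power_zero_numeral zero_le_one zero_le_power2 zero_neq_one)
  then have w: "norm w = 1" by (simp add: w_def)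
  have "trans_prob e w = inverse (?n\<^sup>2) * trans_prob (e + 0) (e + x)"
    by (simp add: w_def trans_prob_commute[of e] trans_prob_scaleR power_inverse)
  also have "trans_prob (e + 0) (e + x) = 1"
    by (subst trans_prob_add_perp[OF e _ x]) (auto simp: perp_def)
  finally have ab: "a\<^sup>2 + b\<^sup>2 = inverse (?n\<^sup>2)"
    using T(2)[OF e w] by (simp add: trans_prob_def a_def b_def)
  have nab: "?n\<^sup>2 * (a\<^sup>2 + b\<^sup>2) = 1" using \<open>?n \<noteq> 0\<close> by (simp add: ab)
  have b0: "\<epsilon> = 0 \<Longrightarrow> - b = 0" by (simp add: b_def inner_J_eq_0)
  \<comment> \<open>The factor is the inverse of the inner product of \<open>T e\<close> and
    \<open>T w\<close>: its conjugate divided by its squared modulus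
    \<open>1 / ?n\<^sup>2\<close>.\<close>
  define u where "u = ?n\<^sup>2 *\<^sub>R (a *\<^sub>R T w + (- b) *\<^sub>R J (T w))"
  have "inner (T e) u = ?n\<^sup>2 * (a\<^sup>2 + b\<^sup>2)"
    using J_skew[of "T e" "T w"] by (simp add: u_def inner_add inner_diff a_def b_def power2_eq_square)
  then have u1: "inner (T e) u = 1" using nab by simp
  have u2: "inner (J (T e)) u = 0"
    using \<epsilon>_cases b0 by (auto simp: u_def inner_add inner_diff inner_J_J a_def[symmetric] b_def[symmetric])
  have v: "u - T e \<in> perp (T e)"
    using u1 u2 T(1)[OF e] by (simp add: perp_def inner_diff norm_eq_1)
  have "(norm u)\<^sup>2 = (?n\<^sup>2)\<^sup>2 * (a\<^sup>2 + b\<^sup>2)"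
    using norm_scalar_mult[OF b0, of a "T w"] T(1)[OF w] by (simp add: u_def power_mult_distrib)
  also have "\<dots> = ?n\<^sup>2 * (?n\<^sup>2 * (a\<^sup>2 + b\<^sup>2))" by (simp add: power2_eq_square[of "?n\<^sup>2"])
  also have "\<dots> = ?n\<^sup>2" unfolding nab by simp
  finally have "(norm (T e + (u - T e)))\<^sup>2 = ?n\<^sup>2" by simp
  then have "(norm (u - T e))\<^sup>2 = (norm x)\<^sup>2"
    unfolding norm_add_perp[OF T(1)[OF e] v] n2 by simp
  then have "norm (u - T e) = norm x" by simp
  moreover have "trans_prob (T e + (u - T e)) z = ?n\<^sup>2 * trans_prob (T w) z" for z
  proof -
    have "trans_prob u z = (?n\<^sup>2)\<^sup>2 * ((a\<^sup>2 + b\<^sup>2) * trans_prob (T w) z)"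
      unfolding u_def trans_prob_scaleR using trans_prob_scalar_mult[OF b0, of a "T w" z] by simp
    also have "\<dots> = ?n\<^sup>2 * (?n\<^sup>2 * (a\<^sup>2 + b\<^sup>2)) * trans_prob (T w) z"
      by (simp add: power2_eq_square[of "?n\<^sup>2"])
    finally show ?thesis unfolding nab by simp
  qed
  ultimately show ?thesis using v unfolding w_def by blast
qed

text \<open>The third property compares chart points with each other. The fourth compares them with
  all \<open>T z\<close>, including those \<open>z\<close> orthogonal to \<open>e\<close>, which lie
  outside the chart.\<close>

lemma wigner_chart:
  assumes T: "\<And>x. norm x = 1 \<Longrightarrow> norm (T x) = 1"
    "\<And>x y. norm x = 1 \<Longrightarrow> norm y = 1 \<Longrightarrow> trans_prob (T x) (T y) = trans_prob x y"
    and e: "norm e = 1"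
  obtains V where "\<And>x. x \<in> perp e \<Longrightarrow> V x \<in> perp (T e)" "\<And>x. x \<in> perp e \<Longrightarrow> norm (V x) = norm x"
    "\<And>x y. x \<in> perp e \<Longrightarrow> y \<in> perp e \<Longrightarrow>
      trans_prob (T e + V x) (T e + V y) = trans_prob (e + x) (e + y)"
    "\<And>x z. x \<in> perp e \<Longrightarrow> norm z = 1 \<Longrightarrow> trans_prob (T e + V x) (T z) = trans_prob (e + x) z"
proof -
  obtain V where V: "\<And>x. x \<in> perp e \<Longrightarrow> V x \<in> perp (T e) \<and> norm (V x) = norm x \<and>
    (\<forall>z. trans_prob (T e + V x) z = (norm (e + x))\<^sup>2 * trans_prob (T ((e + x) /\<^sub>R norm (e + x))) z)"
    using wigner_chart_point[OF T e] by metis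
  have n0: "norm (e + x) \<noteq> 0" if "x \<in> perp e" for x
    using norm_add_perp[OF e that]
    by (metis add_nonneg_eq_0_iff power_zero_numeral zero_le_one zero_le_power2 zero_neq_one)
  have *: "trans_prob (T e + V x) (T z) = trans_prob (e + x) z" if "x \<in> perp e" "norm z = 1" for x z
  proof -
    have "norm ((e + x) /\<^sub>R norm (e + x)) = 1" using n0[OF that(1)] by simp
    then show ?thesis
      using V[OF that(1)] T(2) that n0[OF that(1)] by (simp add: trans_prob_scaleR power_inverse)
  qed
  have "trans_prob (T e + V x) (T e + V y) = trans_prob (e + x) (e + y)"
    if "x \<in> perp e" "y \<in> perp e" for x y
  proof -
    let ?w = "(e + y) /\<^sub>R norm (e + y)"
    have w: "norm ?w = 1" using n0[OF that(2)] by simp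
    have "trans_prob (T e + V x) (T e + V y) = (norm (e + y))\<^sup>2 * trans_prob (T e + V x) (T ?w)"
      using V[OF that(2)] by (simp add: trans_prob_commute[of "T e + V x"])
    also have "\<dots> = (norm (e + y))\<^sup>2 * trans_prob ?w (e + x)"
      using *[OF that(1) w] by (simp add: trans_prob_commute[of "e + x"])
    also have "\<dots> = trans_prob (e + y) (e + x)"
      using n0[OF that(2)] by (simp add: trans_prob_scaleR power_inverse)
    finally show ?thesis by (simp add: trans_prob_commute)
  qed
  with V * that show ?thesis by blast
qed

lemma chart_map_inner:
  assumes e: "norm e = 1" "norm e' = 1"
    and V: "\<And>x. x \<in> perp e \<Longrightarrow> V x \<in> perp e'" "\<And>x. x \<in> perp e \<Longrightarrow> norm (V x) = norm x"
    and tp: "\<And>x y. x \<in> perp e \<Longrightarrow> y \<in> perp e \<Longrightarrow>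
      trans_prob (e' + V x) (e' + V y) = trans_prob (e + x) (e + y)"
    and x: "x \<in> perp e" and y: "y \<in> perp e"
  shows "inner (V x) (V y) = inner x y" "(inner (J (V x)) (V y))\<^sup>2 = (inner (J x) y)\<^sup>2"
proof -
  have eq: "(1 + inner (V x) (V y))\<^sup>2 + (inner (J (V x)) (V y))\<^sup>2 = (1 + inner x y)\<^sup>2 + (inner (J x) y)\<^sup>2"
    if "x \<in> perp e" "y \<in> perp e" for x y
    using tp[OF that] trans_prob_add_perp[OF e(1) that] trans_prob_add_perp[OF e(2) V(1)[OF that(1)] V(1)[OF that(2)]]
    by simp
  \<comment> \<open>The modulus of \<open>1 + \<langle>?p, ?q\<rangle>\<close> is as large as
    Cauchy-Schwarz permits, so the real part of the inner product is maximal and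
    \<open>?p = 2 *\<^sub>R ?q\<close>.\<close>
  have hom: "V (2 *\<^sub>R x) = 2 *\<^sub>R V x"
  proof -
    let ?p = "V (2 *\<^sub>R x)" and ?q = "V x"
    have x2: "2 *\<^sub>R x \<in> perp e" by (rule perp_closed(2)[OF x])
    have n: "norm ?p = 2 * norm x" "norm ?q = norm x" using V(2)[OF x2] V(2)[OF x] by auto
    have "(inner ?p ?q)\<^sup>2 + (inner (J ?p) ?q)\<^sup>2 \<le> (2 * (norm x)\<^sup>2)\<^sup>2"
      using trans_prob_le[of ?p ?q] unfolding n trans_prob_def
      by (simp add: power2_eq_square)
    moreover have "(1 + inner ?p ?q)\<^sup>2 + (inner (J ?p) ?q)\<^sup>2 = (1 + 2 * (norm x)\<^sup>2)\<^sup>2"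
      using eq[OF x2 x] by (simp add: power2_norm_eq_inner)
    ultimately have "inner ?p ?q \<ge> 2 * (norm x)\<^sup>2"
      by (simp add: power2_sum)
    moreover have "(norm (?p - 2 *\<^sub>R ?q))\<^sup>2 = (norm ?p)\<^sup>2 + 4 * (norm ?q)\<^sup>2 - 4 * inner ?p ?q"
      unfolding power2_norm_eq_inner by (simp add: inner_diff inner_commute)
    ultimately have "(norm (?p - 2 *\<^sub>R ?q))\<^sup>2 \<le> 0" unfolding n by (simp add: power_mult_distrib)
    then show ?thesis by simp
  qed
  \<comment> \<open>Doubling \<open>x\<close> scales the linear terms by 2 and the quadratic ones by
    4; comparison with the unscaled identity separates them.\<close>
  have "(1 + 2 * inner (V x) (V y))\<^sup>2 + (2 * inner (J (V x)) (V y))\<^sup>2 = (1 + 2 * inner x y)\<^sup>2 + (2 * inner (J x) y)\<^sup>2"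
    using eq[OF perp_closed(2)[OF x] y, of 2] by (simp add: hom)
  with eq[OF x y] show "inner (V x) (V y) = inner x y"
    by (simp add: power2_sum power_mult_distrib)
  with eq[OF x y] show "(inner (J (V x)) (V y))\<^sup>2 = (inner (J x) y)\<^sup>2" by simp
qed

text \<open>In the expanded squared norm of the defect, \<open>V\<close> can be removed from every
  inner product, and what remains cancels.\<close>

lemma inner_preserving_on_perp_linear:
  assumes V: "\<And>x y. x \<in> perp e \<Longrightarrow> y \<in> perp e \<Longrightarrow> inner (V x) (V y) = inner x y"
    and x: "x \<in> perp e" and y: "y \<in> perp e"
  shows "V (x + y) = V x + V y" "V (r *\<^sub>R x) = r *\<^sub>R V x"
proof -
  note xy = perp_closed(1)[OF x y] and rx = perp_closed(2)[OF x, of r]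
  have "(norm (V (x + y) - (V x + V y)))\<^sup>2 = 0"
    unfolding power2_norm_eq_inner using V x y xy by (simp add: inner_diff inner_add)
  then show "V (x + y) = V x + V y" by simp
  have "(norm (V (r *\<^sub>R x) - r *\<^sub>R V x))\<^sup>2 = 0"
    unfolding power2_norm_eq_inner using V x rx by (simp add: inner_diff)
  then show "V (r *\<^sub>R x) = r *\<^sub>R V x" by simp
qed

text \<open>The two real subspaces on which \<open>V\<close> commutes, respectively anticommutes, with \<open>J\<close>
  cover \<open>perp e\<close>, so one of them is everything.\<close>

lemma inner_preserving_on_perp_sign:
  assumes V: "\<And>x y. x \<in> perp e \<Longrightarrow> y \<in> perp e \<Longrightarrow> inner (V x) (V y) = inner x y"
    and VJ: "\<And>x y. x \<in> perp e \<Longrightarrow> y \<in> perp e \<Longrightarrow> (inner (J (V x)) (V y))\<^sup>2 = (inner (J x) y)\<^sup>2"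
  obtains s :: real where "s = 1 \<or> s = -1" "\<And>x. x \<in> perp e \<Longrightarrow> V (J x) = s *\<^sub>R J (V x)"
proof -
  have alt: "V (J x) = J (V x) \<or> V (J x) = - J (V x)" if x: "x \<in> perp e" for x
  proof -
    note Jx = perp_closed(3)[OF x]
    let ?p = "V (J x)" and ?q = "J (V x)"
    have pp: "inner ?p ?p = \<epsilon> * inner x x" using V[OF Jx Jx] by (simp add: inner_J_J)
    have qq: "inner ?q ?q = \<epsilon> * inner x x" using V[OF x x] by (simp add: inner_J_J)
    \<comment> \<open>This is equality in the real Cauchy-Schwarz inequality for two vectors of
      equal norm, so they agree up to sign.\<close>
    have "(inner ?q ?p)\<^sup>2 = (\<epsilon> * inner x x)\<^sup>2" using VJ[OF x Jx] by (simp add: inner_J_J)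
    then have "inner ?q ?p = \<epsilon> * inner x x \<or> inner ?q ?p = - (\<epsilon> * inner x x)"
      by (simp add: power2_eq_iff)
    then have "(norm (?p - ?q))\<^sup>2 = 0 \<or> (norm (?p + ?q))\<^sup>2 = 0"
      unfolding power2_norm_eq_inner
      by (auto simp: inner_diff inner_add pp qq inner_commute[of ?p ?q])
    then show ?thesis by (auto simp: eq_neg_iff_add_eq_0)
  qed
  have "(\<forall>x\<in>perp e. V (J x) = J (V x)) \<or> (\<forall>x\<in>perp e. V (J x) = - J (V x))"
  proof (rule ccontr)
    assume "\<not> ?thesis"
    then obtain x y where x: "x \<in> perp e" "V (J x) \<noteq> J (V x)" and y: "y \<in> perp e" "V (J y) \<noteq> - J (V y)"
      by blast
    then have x': "V (J x) = - J (V x)" and y': "V (J y) = J (V y)" using alt by blast+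
    have "V (J (x + y)) = V (J x) + V (J y)"
      using inner_preserving_on_perp_linear(1)[OF V] perp_closed(3) x(1) y(1) by simp
    moreover have "V (x + y) = V x + V y"
      by (rule inner_preserving_on_perp_linear(1)[OF V x(1) y(1)])
    ultimately have "- J (V x) = J (V x) \<or> J (V y) = - J (V y)"
      using alt[OF perp_closed(1)[OF x(1) y(1)]] x' y' by auto
    then show False using x(2) y(2) x' y' by metis
  qed
  then show ?thesis using that[of 1] that[of "-1"] by auto
qed

text \<open>The sign \<open>s\<close> separates the linear from the antilinear case. The third
  hypothesis, surjectivity on rays, serves to make \<open>U\<close> surjective.\<close>

lemma wigner:
  fixes T :: "'a \<Rightarrow> 'a" and e :: 'a
  assumes T: "\<And>x. norm x = 1 \<Longrightarrow> norm (T x) = 1"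
    "\<And>x y. norm x = 1 \<Longrightarrow> norm y = 1 \<Longrightarrow> trans_prob (T x) (T y) = trans_prob x y"
    "\<And>y. norm y = 1 \<Longrightarrow> \<exists>x. norm x = 1 \<and> trans_prob (T x) y = 1"
    and e: "norm e = 1"
  obtains s U where "s = 1 \<or> s = -1" "linear U" "\<forall>x. U (J x) = s *\<^sub>R J (U x)"
    "\<forall>x. norm (U x) = norm x" "surj U" "\<forall>x. norm x = 1 \<longrightarrow> trans_prob (T x) (U x) = 1"
proof -
  obtain V where V: "\<And>x. x \<in> perp e \<Longrightarrow> V x \<in> perp (T e)" "\<And>x. x \<in> perp e \<Longrightarrow> norm (V x) = norm x"
    and V_tp: "\<And>x y. x \<in> perp e \<Longrightarrow> y \<in> perp e \<Longrightarrow>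
      trans_prob (T e + V x) (T e + V y) = trans_prob (e + x) (e + y)"
    and V_T: "\<And>x z. x \<in> perp e \<Longrightarrow> norm z = 1 \<Longrightarrow> trans_prob (T e + V x) (T z) = trans_prob (e + x) z"
    using wigner_chart[OF T(1,2) e] by blast
  have Te: "norm (T e) = 1" by (rule T(1)[OF e])
  have V_inner: "inner (V x) (V y) = inner x y" "(inner (J (V x)) (V y))\<^sup>2 = (inner (J x) y)\<^sup>2"
    if "x \<in> perp e" "y \<in> perp e" for x y
    using chart_map_inner[OF e Te V V_tp that] by simp_all
  have V_lin: "V (x + y) = V x + V y" "V (r *\<^sub>R x) = r *\<^sub>R V x"
    if "x \<in> perp e" "y \<in> perp e" for x y r
    using inner_preserving_on_perp_linear[of e V, OF V_inner(1) that] by simp_all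
  obtain s where s: "s = 1 \<or> s = -1" and V_J: "\<And>x. x \<in> perp e \<Longrightarrow> V (J x) = s *\<^sub>R J (V x)"
    using inner_preserving_on_perp_sign[OF V_inner] by blast
  have ss: "s * s = 1" using s by auto
  let ?pr = "coray_proj e"
  note pr = coray_proj_in_perp[OF e]
  \<comment> \<open>\<open>U\<close> sends \<open>e\<close> to \<open>T e\<close> and extends
    \<open>V\<close>; the factor \<open>s\<close> gives it the same commutation rule with
    \<open>J\<close> on the line of \<open>e\<close>.\<close>
  define U where "U w = inner e w *\<^sub>R T e + (s * inner (J e) w) *\<^sub>R J (T e) + V (?pr w)" for w
  have U_lin: "linear U"
  proof (rule linearI)
    show "U (x + y) = U x + U y" for x y
      using V_lin(1)[OF pr pr, of x y]
      by (simp add: U_def linear_add[OF linear_coray_proj] inner_add algebra_simps)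
    show "U (r *\<^sub>R x) = r *\<^sub>R U x" for r x
      using V_lin(2)[OF pr pr, of r x]
      by (simp add: U_def linear_scale[OF linear_coray_proj] algebra_simps)
  qed
  have U_J: "U (J w) = s *\<^sub>R J (U w)" for w
  proof -
    have "?pr (J w) = J (?pr w)" by (simp add: coray_proj_def ray_op_J)
    then show ?thesis
      using V_J[OF pr, of w] J_skew[of e w] \<epsilon>_cases ss
      by (auto simp: U_def inner_J_J J_J algebra_simps)
  qed
  have U_norm: "norm (U w) = norm w" for w
  proof -
    have perp: "inner (T e) (V (?pr w)) = 0" "inner (J (T e)) (V (?pr w)) = 0"
      using V(1)[OF pr, of w] by (auto simp: perp_def)
    have b0: "\<epsilon> = 0 \<Longrightarrow> s * inner (J e) w = 0" by (simp add: inner_J_eq_0)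
    have "(norm (U w))\<^sup>2 = (norm (inner e w *\<^sub>R T e + (s * inner (J e) w) *\<^sub>R J (T e)))\<^sup>2 + (norm (V (?pr w)))\<^sup>2"
      unfolding power2_norm_eq_inner U_def using perp by (simp add: inner_add inner_commute)
    also have "\<dots> = trans_prob e w + (norm (?pr w))\<^sup>2"
      using norm_scalar_mult[OF b0, of "inner e w" "T e"] ss
      by (simp add: V(2)[OF pr] trans_prob_def Te power_mult_distrib power2_eq_square[of s])
    also have "\<dots> = (norm w)\<^sup>2" by (simp add: norm_coray_proj[OF e])
    finally show ?thesis by simp
  qed
  have U_chart: "U (e + x) = T e + V x" if "x \<in> perp e" for x
  proof -
    have "?pr (e + x) = x"
      using that e by (simp add: linear_add[OF linear_coray_proj] coray_proj_eq_self)
        (simp add: coray_proj_def ray_op_self)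
    then show ?thesis using that e by (simp add: U_def inner_add perp_def norm_eq_1)
  qed
  have U_T: "trans_prob (T w) (U w) = 1" if w: "norm w = 1" for w
  proof (cases "trans_prob e w = 0")
    case True
    then have wp: "w \<in> perp e" by (simp add: trans_prob_eq_0_iff perp_def)
    have "trans_prob (T e) (T w) = 0" using True T(2)[OF e w] by simp
    then have Tw: "inner (T e) (T w) = 0" "inner (J (T e)) (T w) = 0" by (auto simp: trans_prob_eq_0_iff)
    have "U w = V w" using wp by (simp add: U_def coray_proj_eq_self) (simp add: perp_def)
    \<comment> \<open>Here \<open>w\<close> has no chart point, but adding \<open>T e\<close> is
      harmless because \<open>T w\<close> is orthogonal to it.\<close>
    then have "trans_prob (U w) (T w) = trans_prob (T e + V w) (T w)"
      using Tw by (simp add: trans_prob_def inner_add)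
    also have "\<dots> = trans_prob (e + w) w" by (rule V_T[OF wp w])
    also have "\<dots> = 1" using wp w by (simp add: trans_prob_def inner_add perp_def norm_eq_1)
    finally show ?thesis by (simp add: trans_prob_commute)
  next
    case False
    define a b where "a = inner e w" and "b = inner (J e) w"
    define N where "N = a\<^sup>2 + b\<^sup>2"
    have N: "N \<noteq> 0" using False by (simp add: N_def a_def b_def trans_prob_def)
    have b0: "\<epsilon> = 0 \<Longrightarrow> b = 0" by (simp add: b_def inner_J_eq_0)
    \<comment> \<open>The multiple of \<open>w\<close> whose component along \<open>e\<close> is
      exactly \<open>e\<close>, so that \<open>y\<close> is a chart point.\<close>
    define y where "y = (1 / N) *\<^sub>R (a *\<^sub>R w - b *\<^sub>R J w)"
    have "inner e y = 1" "inner (J e) y = 0"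
    proof -
      have "inner e y = (1 / N) * (a * a + b * b)"
        unfolding y_def using J_skew[of e w]
        by (simp only: inner_diff inner_scaleR_right a_def[symmetric] b_def[symmetric]) simp
      then show "inner e y = 1" using N by (simp add: N_def power2_eq_square)
      show "inner (J e) y = 0"
        using \<epsilon>_cases b0 by (auto simp: y_def inner_diff inner_J_J a_def[symmetric] b_def[symmetric])
    qed
    then have x: "y - e \<in> perp e" using e by (simp add: perp_def inner_diff norm_eq_1)
    have "N *\<^sub>R (a *\<^sub>R y + b *\<^sub>R J y) = a *\<^sub>R (N *\<^sub>R y) + b *\<^sub>R J (N *\<^sub>R y)"
      by (simp add: algebra_simps)
    also have "N *\<^sub>R y = a *\<^sub>R w - b *\<^sub>R J w" using N by (simp add: y_def)
    also have "a *\<^sub>R (a *\<^sub>R w - b *\<^sub>R J w) + b *\<^sub>R J (a *\<^sub>R w - b *\<^sub>R J w) = N *\<^sub>R w"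
      using \<epsilon>_cases b0 by (auto simp: N_def J_J power2_eq_square algebra_simps)
    finally have wy: "w = a *\<^sub>R y + b *\<^sub>R J y" using N by simp
    have "U w = a *\<^sub>R U y + (s * b) *\<^sub>R J (U y)"
      by (subst wy) (simp add: linear_add[OF U_lin] linear_scale[OF U_lin] U_J mult.commute)
    then have "trans_prob (U w) (T w) = (a\<^sup>2 + (s * b)\<^sup>2) * trans_prob (U y) (T w)"
      using trans_prob_scalar_mult[of "s * b" a "U y" "T w"] b0 by simp
    also have "trans_prob (U y) (T w) = trans_prob y w"
      using V_T[OF x w] U_chart[OF x] by simp
    also have "(a\<^sup>2 + (s * b)\<^sup>2) * trans_prob y w = (a\<^sup>2 + b\<^sup>2) * trans_prob y w"
      using ss by (simp add: power_mult_distrib power2_eq_square)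
    also have "\<dots> = trans_prob (a *\<^sub>R y + b *\<^sub>R J y) w"
      using trans_prob_scalar_mult[OF b0] by simp
    also have "\<dots> = 1" by (simp add: wy[symmetric] trans_prob_self w)
    finally show ?thesis by (simp add: trans_prob_commute)
  qed
  have "surj U"
    unfolding surj_def
  proof
    fix y
    show "\<exists>x. y = U x"
    proof (cases "y = 0")
      case True
      then show ?thesis using linear_0[OF U_lin] by metis
    next
      case False
      let ?y = "y /\<^sub>R norm y"
      have y: "norm ?y = 1" using False by simp
      obtain x where x: "norm x = 1" "trans_prob (T x) ?y = 1" using T(3)[OF y] by blast
      have Ux: "norm (U x) = 1" by (simp add: U_norm x)
      have "ray_op (T x) = ray_op (U x)"
        by (rule ray_op_cong[OF T(1)[OF x(1)] Ux U_T[OF x(1)]])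
      then have "?y = ray_op (U x) ?y"
        using ray_op_eq_self[OF T(1)[OF x(1)] y x(2)] by simp
      \<comment> \<open>The phase between \<open>U x\<close> and the target is absorbed into the
        argument, using \<open>U (J x) = s *\<^sub>R J (U x)\<close> and
        \<open>s * s = 1\<close>.\<close>
      also have "\<dots> = U (inner (U x) ?y *\<^sub>R x + (s * inner (J (U x)) ?y) *\<^sub>R J x)"
        using ss by (simp add: ray_op_def linear_add[OF U_lin] linear_scale[OF U_lin] U_J algebra_simps)
      finally obtain z where "?y = U z" by blast
      then have "y = U (norm y *\<^sub>R z)"
        using False by (metis linear_scale[OF U_lin] norm_eq_zero scaleR_scaleR right_inverse scaleR_one)
      then show ?thesis by blast
    qed
  qed
  with s U_lin U_J U_norm U_T that show ?thesis by blast
qed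

section \<open>Angle-preserving maps\<close>

text \<open>Lets \<open>T x\<close> be replaced by \<open>U x\<close>, which is another unit vector
  on the same ray.\<close>

lemma norm_projection_ray:
  assumes R: "is_projection cs R" and "norm x = 1" "norm y = 1" "trans_prob x y = 1"
  shows "(norm (R y))\<^sup>2 = (norm (R x))\<^sup>2"
proof -
  note RD = projectionD[OF R]
  have "R y = R (ray_op x y)" using ray_op_eq_self[OF assms(2-4)] by simp
  also have "\<dots> = inner x y *\<^sub>R R x + inner (J x) y *\<^sub>R J (R x)"
    by (simp add: ray_op_def linear_add[OF RD(1)] linear_scale[OF RD(1)] RD(2))
  finally have "(norm (R y))\<^sup>2 = trans_prob x y * (norm (R x))\<^sup>2"
    unfolding trans_prob_def by (metis norm_scalar_mult inner_J_eq_0)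
  then show ?thesis using assms(4) by simp
qed

lemma angle_preserver_implemented:
  assumes inf: "infinite_dimensional_set (UNIV :: 'a set)"
    and surj: "\<phi> ` proj_inf cs = proj_inf cs"
    and ang: "\<And>P Q. P \<in> proj_inf cs \<Longrightarrow> Q \<in> proj_inf cs \<Longrightarrow> same_angle cs (\<phi> P) (\<phi> Q) P Q"
  obtains s U where "s = 1 \<or> s = -1" "linear U" "\<forall>x. U (J x) = s *\<^sub>R J (U x)"
    "\<forall>x. norm (U x) = norm x" "surj U" "\<forall>P\<in>proj_inf cs. \<forall>x. \<phi> P (U x) = U (P x)"
proof -
  have \<phi>_in: "\<phi> P \<in> proj_inf cs" if "P \<in> proj_inf cs" for P using surj that by blast
  have proj: "is_projection cs P" if "P \<in> proj_inf cs" for P using that by (simp add: proj_inf_def)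
  \<comment> \<open>The case \<open>P = Q\<close> of the angle condition.\<close>
  have \<phi>_equiv: "unitarily_equivalent cs (\<phi> P) P" if P: "P \<in> proj_inf cs" for P
  proof -
    have "P \<circ> P \<circ> P = P" "\<phi> P \<circ> \<phi> P \<circ> \<phi> P = \<phi> P"
      using proj[OF P] proj[OF \<phi>_in[OF P]] by (auto simp: is_projection_def)
    then show ?thesis using ang[OF P P] by (simp add: same_angle_def)
  qed
  note co = coray_proj_in_proj_inf[OF inf]
  have "\<exists>y. norm y = 1 \<and> \<phi> (coray_proj x) = coray_proj y" if "norm x = 1" for x
    using unitarily_equivalent_coray_proj[OF \<phi>_equiv[OF co[OF that]] that] by blast
  then obtain T where T1: "\<And>x. norm x = 1 \<Longrightarrow> norm (T x) = 1"
    and \<phi>_co: "\<And>x. norm x = 1 \<Longrightarrow> \<phi> (coray_proj x) = coray_proj (T x)"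
    by metis
  have equiv: "unitarily_equivalent cs (\<phi> R \<circ> coray_proj (T x) \<circ> \<phi> R) (R \<circ> coray_proj x \<circ> R)"
    if "R \<in> proj_inf cs" "norm x = 1" for R x
    using ang[OF co[OF that(2)] that(1)] by (simp add: same_angle_def \<phi>_co[OF that(2)])
  have fwd: "(norm (\<phi> R (T x)))\<^sup>2 = (norm (R x))\<^sup>2"
    if "R \<in> proj_inf cs" "norm x = 1" "0 < (norm (R x))\<^sup>2" "(norm (R x))\<^sup>2 < 1" for R x
    using projection_norm_eq_if_same_angle[OF proj[OF that(1)] proj[OF \<phi>_in[OF that(1)]] that(2) T1[OF that(2)]
      unitarily_equivalent_sym[OF equiv[OF that(1,2)]] that(3,4)] .
  \<comment> \<open>Both directions are kept: the eigenvalue argument is silent at 0 and 1, so each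
    of them assumes strict bounds on its own side.\<close>
  have bwd: "(norm (R x))\<^sup>2 = (norm (\<phi> R (T x)))\<^sup>2"
    if "R \<in> proj_inf cs" "norm x = 1" "0 < (norm (\<phi> R (T x)))\<^sup>2" "(norm (\<phi> R (T x)))\<^sup>2 < 1" for R x
    using projection_norm_eq_if_same_angle[OF proj[OF \<phi>_in[OF that(1)]] proj[OF that(1)] T1[OF that(2)] that(2)
      equiv[OF that(1,2)] that(3,4)] .
  have tp_fwd: "trans_prob (T x) (T y) = trans_prob x y"
    if "norm x = 1" "norm y = 1" "0 < trans_prob x y" "trans_prob x y < 1" for x y
    using fwd[OF co[OF that(1)] that(2)] that T1
    by (simp add: norm_coray_proj \<phi>_co)
  have tp_bwd: "trans_prob (T x) (T y) = trans_prob x y"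
    if "norm x = 1" "norm y = 1" "0 < trans_prob (T x) (T y)" "trans_prob (T x) (T y) < 1" for x y
    using bwd[OF co[OF that(1)] that(2)] that T1
    by (simp add: norm_coray_proj \<phi>_co)
  have tp_1: "trans_prob (T x) (T y) = 1" if "norm x = 1" "norm y = 1" "trans_prob x y = 1" for x y
  proof -
    have "coray_proj x = coray_proj y" using ray_op_cong[OF that] by (auto simp: coray_proj_def)
    then have "coray_proj (T x) = coray_proj (T y)" using \<phi>_co that by metis
    then have "trans_prob (T x) (T y) = trans_prob (T y) (T y)"
      using trans_prob_if_coray_proj_eq T1 that by blast
    then show ?thesis using T1[OF that(2)] by (simp add: trans_prob_self)
  qed
  have tp_0: "trans_prob (T x) (T y) \<noteq> 1" if xy: "norm x = 1" "norm y = 1" "trans_prob x y = 0" for x y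
  proof
    assume eq1: "trans_prob (T x) (T y) = 1"
    have perp: "inner x y = 0" "inner (J x) y = 0" "inner (J y) x = 0"
      using xy(3) J_skew[of y x] by (auto simp: trans_prob_eq_0_iff inner_commute)
    \<comment> \<open>If \<open>T x\<close> and \<open>T y\<close> were on one ray,
      \<open>T r\<close> would have equal transition probabilities to both. For this unit vector
      they are 9/25 and 16/25, values that \<open>tp_fwd\<close> preserves.\<close>
    define r where "r = (3/5) *\<^sub>R x + (4/5) *\<^sub>R y"
    have "inner r r = 1"
      using xy perp by (simp add: r_def inner_add inner_commute norm_eq_1)
    then have r: "norm r = 1" by (simp add: norm_eq_1)
    have "trans_prob x r = 9/25" "trans_prob y r = 16/25"
      using xy perp by (simp_all add: r_def trans_prob_def inner_add inner_commute norm_eq_1 power2_eq_square)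
    then have "trans_prob (T x) (T r) = 9/25" "trans_prob (T y) (T r) = 16/25"
      using tp_fwd xy r by simp_all
    moreover have "ray_op (T x) = ray_op (T y)"
      by (rule ray_op_cong[OF T1[OF xy(1)] T1[OF xy(2)] eq1])
    then have "trans_prob (T x) (T r) = trans_prob (T y) (T r)" by (metis inner_ray_op)
    ultimately show False by simp
  qed
  have T2: "trans_prob (T x) (T y) = trans_prob x y" if xy: "norm x = 1" "norm y = 1" for x y
  proof -
    have b: "0 \<le> trans_prob x y" "trans_prob x y \<le> 1"
        "0 \<le> trans_prob (T x) (T y)" "trans_prob (T x) (T y) \<le> 1"
      using trans_prob_nonneg trans_prob_le[of x y] trans_prob_le[of "T x" "T y"] xy T1 by auto
    consider "trans_prob x y = 0" | "trans_prob x y = 1" | "0 < trans_prob x y" "trans_prob x y < 1"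
      using b by linarith
    then show ?thesis
    proof cases
      case 1
      \<comment> \<open>An image value strictly between 0 and 1 would be the original value, and 1
        is excluded by \<open>tp_0\<close>; only 0 is left.\<close>
      then have "\<not> (0 < trans_prob (T x) (T y) \<and> trans_prob (T x) (T y) < 1)"
        using tp_bwd[OF xy] by auto
      then show ?thesis using b 1 tp_0[OF xy 1] by linarith
    qed (use tp_1 tp_fwd xy in simp_all)
  qed
  have T3: "\<exists>x. norm x = 1 \<and> trans_prob (T x) y = 1" if y: "norm y = 1" for y
  proof -
    \<comment> \<open>A preimage of a coray projection is unitarily equivalent to it, hence a coray
      projection itself.\<close>
    obtain Q where Q: "Q \<in> proj_inf cs" "\<phi> Q = coray_proj y"
      using co[OF y] surj by (metis imageE)
    have "unitarily_equivalent cs Q (coray_proj y)"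
      using unitarily_equivalent_sym[OF \<phi>_equiv[OF Q(1)]] Q(2) by simp
    then obtain x where x: "norm x = 1" "Q = coray_proj x"
      using unitarily_equivalent_coray_proj y by blast
    then have "coray_proj (T x) = coray_proj y" using \<phi>_co Q by simp
    then have "trans_prob (T x) y = trans_prob y y"
      using trans_prob_if_coray_proj_eq T1 x y by blast
    then show ?thesis using x y by (auto simp: trans_prob_self)
  qed
  obtain v :: 'a where "v \<noteq> 0"
  proof -
    have "\<not> (UNIV :: 'a set) \<subseteq> span {}"
      using inf finite.emptyI unfolding infinite_dimensional_set_def by (metis (no_types))
    then show ?thesis using that by auto
  qed
  then have v: "norm (v /\<^sub>R norm v) = 1" by simp
  obtain s U where U': "s = 1 \<or> s = -1" "linear U"
    "\<forall>x. U (J x) = s *\<^sub>R J (U x)" "\<forall>x. norm (U x) = norm x" "surj U"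
    "\<forall>x. norm x = 1 \<longrightarrow> trans_prob (T x) (U x) = 1"
    by (rule wigner[of T, OF T1 T2 T3 v])
  note U = U'[rule_format]
  have "\<phi> R (U z) = U (R z)" if R: "R \<in> proj_inf cs" for R z
  \<comment> \<open>The identity has no kernel vectors to mix with, but only the identity is
    unitarily equivalent to it.\<close>
  proof (cases "\<forall>z. R z = z")
    case True
    obtain V where V: "linear V" "\<And>x. norm (V x) = norm x" "V \<circ> \<phi> R = R \<circ> V"
      using \<phi>_equiv[OF R] by (auto simp: unitarily_equivalent_def unitary_op_iff K_isometry_def)
    have "V (\<phi> R (U z)) = V (U z)" using fun_cong[OF V(3), of "U z"] True by simp
    then show ?thesis using inj_isometry[OF V(1,2)] True by (simp add: inj_def)
  next
    case False
    note RD = projectionD[OF proj[OF R]] and RD' = projectionD[OF proj[OF \<phi>_in[OF R]]]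
    have g: "(norm (\<phi> R (U x)))\<^sup>2 = (norm (R x))\<^sup>2"
      if "norm x = 1" "0 < (norm (R x))\<^sup>2" "(norm (R x))\<^sup>2 < 1" for x
      using fwd[OF R that] norm_projection_ray[OF proj[OF \<phi>_in[OF R]] T1[OF that(1)] _ U(6)[OF that(1)]]
        U(4) that(1) by simp
    have key: "\<phi> R (U x) = U x" "\<phi> R (U y) = 0"
      if x: "norm x = 1" "R x = x" and y: "norm y = 1" "R y = 0" for x y
    proof -
      define A where "A = (norm (\<phi> R (U x)))\<^sup>2"
      define B where "B = (norm (\<phi> R (U y)))\<^sup>2"
      define C where "C = inner (\<phi> R (U x)) (\<phi> R (U y))"
      have xy: "inner x y = 0" using RD(4)[of x y] x y by simp
      \<comment> \<open>Mixing \<open>x\<close> and \<open>y\<close> with nonzero weights gives a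
        unit vector in neither the range nor the kernel of \<open>R\<close>, where \<open>g\<close>
        applies.\<close>
      have *: "c\<^sup>2 * A + d\<^sup>2 * B + 2 * c * d * C = c\<^sup>2"
        if cd: "c\<^sup>2 + d\<^sup>2 = 1" "c \<noteq> 0" "d \<noteq> 0" for c d
      proof -
        let ?w = "c *\<^sub>R x + d *\<^sub>R y"
        have "inner ?w ?w = c\<^sup>2 + d\<^sup>2"
          using x y xy by (simp add: inner_add inner_commute norm_eq_1 power2_eq_square)
        then have w: "norm ?w = 1" using cd by (simp add: norm_eq_1)
        have Rw: "(norm (R ?w))\<^sup>2 = c\<^sup>2"
          using x y by (simp add: linear_add[OF RD(1)] linear_scale[OF RD(1)])
        have "0 < c\<^sup>2" "0 < d\<^sup>2" using cd(2,3) by simp_all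
        with cd(1) have "0 < c\<^sup>2" "c\<^sup>2 < 1" by linarith+
        then have "(norm (\<phi> R (U ?w)))\<^sup>2 = c\<^sup>2" using g[OF w] Rw by simp
        moreover have "\<phi> R (U ?w) = c *\<^sub>R \<phi> R (U x) + d *\<^sub>R \<phi> R (U y)"
          by (simp add: linear_add[OF RD'(1)] linear_scale[OF RD'(1)] linear_add[OF U(2)] linear_scale[OF U(2)])
        then have "(norm (\<phi> R (U ?w)))\<^sup>2 = c\<^sup>2 * A + d\<^sup>2 * B + 2 * c * d * C"
          unfolding A_def B_def C_def power2_norm_eq_inner
          by (simp add: inner_add inner_commute power2_eq_square)
        ultimately show ?thesis by simp
      qed
      \<comment> \<open>Flipping the sign of \<open>d\<close> eliminates \<open>C\<close>; two
        different weight ratios then determine \<open>A\<close> and \<open>B\<close>.\<close>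
      have "A = 1 \<and> B = 0"
        using *[of "3/5" "4/5"] *[of "3/5" "-4/5"] *[of "4/5" "3/5"] by (simp add: power2_eq_square)
      then show "\<phi> R (U x) = U x" "\<phi> R (U y) = 0"
        using projection_norm_complement[OF proj[OF \<phi>_in[OF R]], of "U x"] x U(4) by (simp_all add: A_def B_def)
    qed
    \<comment> \<open>Fixed unit vectors in the kernel and, below, in the range act as partners when
      \<open>key\<close> is applied to arbitrary vectors.\<close>
    obtain y0 where "R y0 \<noteq> y0" using False by blast
    define y where "y = (y0 - R y0) /\<^sub>R norm (y0 - R y0)"
    have y: "norm y = 1" "R y = 0"
      using \<open>R y0 \<noteq> y0\<close> by (simp_all add: y_def linear_diff[OF RD(1)] linear_scale[OF RD(1)] RD(3))
    obtain x0 where "R x0 \<noteq> 0"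
    proof -
      have "\<not> range R \<subseteq> span {}"
        using R finite.emptyI unfolding proj_inf_def infinite_dimensional_set_def mem_Collect_eq
        by (metis (no_types))
      then show ?thesis using that by auto
    qed
    define x where "x = R x0 /\<^sub>R norm (R x0)"
    have x: "norm x = 1" "R x = x"
      using \<open>R x0 \<noteq> 0\<close> by (simp_all add: x_def linear_scale[OF RD(1)] RD(3))
    have ran: "\<phi> R (U w) = U w" if "R w = w" for w
    proof (cases "w = 0")
      case False
      have "\<phi> R (U (w /\<^sub>R norm w)) = U (w /\<^sub>R norm w)"
        using False that by (intro key(1)[OF _ _ y]) (auto simp: linear_scale[OF RD(1)])
      then show ?thesis
        using False by (simp add: linear_scale[OF RD'(1)] linear_scale[OF U(2)])
    qed (simp add: linear_0[OF RD'(1)] linear_0[OF U(2)])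
    have ker: "\<phi> R (U w) = 0" if "R w = 0" for w
    proof (cases "w = 0")
      case False
      have "\<phi> R (U (w /\<^sub>R norm w)) = 0"
        using False that by (intro key(2)[OF x]) (auto simp: linear_scale[OF RD(1)])
      then show ?thesis
        using False by (simp add: linear_scale[OF RD'(1)] linear_scale[OF U(2)])
    qed (simp add: linear_0[OF RD'(1)] linear_0[OF U(2)])
    have "R (z - R z) = 0" by (simp add: linear_diff[OF RD(1)] RD(3))
    then have "\<phi> R (U (z - R z)) = 0" by (rule ker)
    then have "\<phi> R (U z) = \<phi> R (U (R z))"
      by (simp add: linear_diff[OF U(2)] linear_diff[OF RD'(1)])
    then show ?thesis using ran[OF RD(3)] by simp
  qed
  with U'(1-5) that show ?thesis by blast
qed

end

text \<open>\<open>inv U\<close> is the adjoint of \<open>U\<close>, because \<open>U\<close> is a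
  surjective isometry.\<close>

theorem theorem4:
  fixes cs :: "('a::{real_inner, complete_space} \<Rightarrow> 'a) option"
    and \<phi> :: "('a \<Rightarrow> 'a) \<Rightarrow> ('a \<Rightarrow> 'a)"
  assumes "scalars_ok cs"
    and "infinite_dimensional_set (UNIV :: 'a set)"
    and "\<phi> ` proj_inf cs = proj_inf cs"
    and "\<forall>P\<in>proj_inf cs. \<forall>Q\<in>proj_inf cs. same_angle cs (\<phi> P) (\<phi> Q) P Q"
  shows "\<exists>U. (unitary_op cs U \<or> antiunitary_op cs U) \<and>
           (\<forall>P\<in>proj_inf cs. \<phi> P = U \<circ> P \<circ> inv U)"
proof -
  obtain J \<epsilon> where "scalar_field cs J \<epsilon>"
    using scalar_field_of_scalars_ok[OF assms(1)] by blast
  then interpret scalar_field cs J \<epsilon> .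
  obtain s U where U': "s = 1 \<or> s = -1" "linear U" "\<forall>x. U (J x) = s *\<^sub>R J (U x)"
    "\<forall>x. norm (U x) = norm x" "surj U" "\<forall>P\<in>proj_inf cs. \<forall>x. \<phi> P (U x) = U (P x)"
    by (rule angle_preserver_implemented[OF assms(2,3) assms(4)[rule_format]])
  note U = U'[rule_format]
  have "bounded_linear U" by (rule bounded_linear_isometry[OF U(2,4)])
  \<comment> \<open>In the complex case \<open>s = 1\<close> gives a unitary and
    \<open>s = -1\<close> an antiunitary operator; in the real case \<open>J = 0\<close> and either
    sign gives an orthogonal one.\<close>
  then have "unitary_op cs U \<or> antiunitary_op cs U"
    using U cs_cases by (auto simp: unitary_op_iff K_isometry_def antiunitary_op_def linear_0)
  moreover have "\<phi> P = U \<circ> P \<circ> inv U" if "P \<in> proj_inf cs" for P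
  proof
    fix z
    show "\<phi> P z = (U \<circ> P \<circ> inv U) z"
      using U(6)[OF that, of "inv U z"] U(5) by (simp add: surj_f_inv_f)
  qed
  ultimately show ?thesis by blast
qed

end
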